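(* There is no real-valued function $a$ on the set of anti-linear involutions of a complex line satisfying both of the following: (i) $a$ is invariant under complex-linear conjugacy; (ii) for every pair of anti-linear involutions $\sigma,\rho$ of the line, the quantity $$a(\sigma)+a(\rho)-\operatorname{age}(\sigma\rho)$$ is an integer whenever $\sigma\rho\neq 1$.
   Context: A complex line is a one-dimensional complex vector space. The composition $\sigma\rho$ of two anti-linear involutions of a complex line is complex linear, namely multiplication by a unit complex number $e^{2\pi i\varphi}$ with $\varphi\in[0,1)$; $\operatorname{age}(\sigma\rho):=\varphi$. Complex-linear conjugacy invariance means $a(U\sigma U^{-1})=a(\sigma)$ for every complex-linear automorphism $U$. *)

theory Defs
  imports Complex_Main
begin

text \<open>
  A complex line is given by its scalar multiplication \<open>s\<close> on an additive group; the vector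
  space axioms and the dimension are those of the library locale \<^locale>\<open>vector_space\<close>.
\<close>

definition complex_line :: "(complex \<Rightarrow> 'v::ab_group_add \<Rightarrow> 'v) \<Rightarrow> bool" where
  "complex_line s \<longleftrightarrow> vector_space s \<and> vector_space.dim s UNIV = 1"

definition antilinear_involution ::
    "(complex \<Rightarrow> 'v::ab_group_add \<Rightarrow> 'v) \<Rightarrow> ('v \<Rightarrow> 'v) \<Rightarrow> bool" where
  "antilinear_involution s \<sigma> \<longleftrightarrow>
     (\<forall>x y. \<sigma> (x + y) = \<sigma> x + \<sigma> y) \<and>
     (\<forall>c x. \<sigma> (s c x) = s (cnj c) (\<sigma> x)) \<and>
     \<sigma> \<circ> \<sigma> = id"

definition linear_automorphism ::
    "(complex \<Rightarrow> 'v::ab_group_add \<Rightarrow> 'v) \<Rightarrow> ('v \<Rightarrow> 'v) \<Rightarrow> bool" where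
  "linear_automorphism s U \<longleftrightarrow> Vector_Spaces.linear s s U \<and> bij U"

text \<open>
  The description below determines \<open>\<phi>\<close> uniquely when \<open>T\<close> is multiplication by a unit complex
  number on a complex line, in particular when \<open>T\<close> is a composition of two anti-linear
  involutions (see \<open>age_well_defined\<close>); for other maps \<open>age s T\<close> is unspecified.
\<close>

definition age :: "(complex \<Rightarrow> 'v::ab_group_add \<Rightarrow> 'v) \<Rightarrow> ('v \<Rightarrow> 'v) \<Rightarrow> real" where
  "age s T = (THE \<phi>. 0 \<le> \<phi> \<and> \<phi> < 1 \<and>
     (\<forall>x. T x = s (exp (2 * of_real pi * \<i> * of_real \<phi>)) x))"

lemma complex_line_generator:
  assumes "complex_line s"
  obtains b where "b \<noteq> 0" "\<And>x. \<exists>c. x = s c b"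
proof -
  interpret vector_space s
    using assms by (simp add: complex_line_def)
  have d: "dim UNIV = 1"
    using assms by (simp add: complex_line_def)
  obtain B where B: "independent B" "UNIV \<subseteq> span B" "card B = dim UNIV"
    using basis_exists[of UNIV] by blast
  then obtain b where b: "B = {b}"
    using d by (metis card_1_singletonE)
  have "b \<noteq> 0"
    using B(1) b dependent_zero by blast
  moreover have "\<exists>c. x = s c b" for x
    using B(2) b by (auto simp: span_singleton)
  ultimately show thesis
    using that by blast
qed

lemma age_well_defined:
  assumes L: "complex_line s"
    and "antilinear_involution s \<sigma>" and "antilinear_involution s \<rho>"
  shows "\<exists>!\<phi>::real. 0 \<le> \<phi> \<and> \<phi> < 1 \<and>
     (\<forall>x. (\<sigma> \<circ> \<rho>) x = s (exp (2 * of_real pi * \<i> * of_real \<phi>)) x)"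
proof -
  interpret vector_space s
    using L by (simp add: complex_line_def)
  obtain b where b: "b \<noteq> 0" "\<And>x. \<exists>c. x = s c b"
    using complex_line_generator[OF L] by blast
  have inj: "c = d" if "s c b = s d b" for c d
    using that b(1) by (metis scale_right_imp_eq)
  have coeff: "\<exists>u. cmod u = 1 \<and> (\<forall>c. \<tau> (s c b) = s (cnj c * u) b)"
    if t: "antilinear_involution s \<tau>" for \<tau>
  proof -
    have al: "\<tau> (s c x) = s (cnj c) (\<tau> x)" and inv: "\<tau> (\<tau> x) = x" for c x
      using t by (auto simp: antilinear_involution_def fun_eq_iff)
    obtain u where u: "\<tau> b = s u b"
      using b(2) by blast
    have "s (cnj u * u) b = s 1 b"
      using inv[of b] by (simp add: u al)
    then have "cnj u * u = 1"
      by (rule inj)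
    then have "(cmod u)\<^sup>2 = 1"
      by (metis complex_norm_square mult.commute of_real_eq_1_iff)
    then have "cmod u = 1"
      using power2_eq_iff_nonneg[of "cmod u" 1] by simp
    then show ?thesis
      by (auto simp: al u)
  qed
  obtain u where u: "cmod u = 1" "\<And>c. \<sigma> (s c b) = s (cnj c * u) b"
    using coeff[OF assms(2)] by blast
  obtain v where v: "cmod v = 1" "\<And>c. \<rho> (s c b) = s (cnj c * v) b"
    using coeff[OF assms(3)] by blast
  define w where "w = cnj v * u"
  have w: "cmod w = 1"
    by (simp add: w_def norm_mult u v)
  have comp: "(\<sigma> \<circ> \<rho>) x = s w x" for x
    using b(2)[of x] by (auto simp: u v w_def mult_ac)
  have eq: "(\<forall>x. (\<sigma> \<circ> \<rho>) x = s z x) \<longleftrightarrow> w = z" for z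
    using comp inj by auto
  have cis: "exp (2 * of_real pi * \<i> * of_real \<phi>) = cis (2 * pi * \<phi>)" for \<phi> :: real
    by (simp add: cis_conv_exp mult_ac)
  show ?thesis
    unfolding eq cis
  proof (rule ex_ex1I)
    have "(Re w)\<^sup>2 + (Im w)\<^sup>2 = 1"
      using w by (simp flip: cmod_power2)
    then obtain t where "0 \<le> t" "t < 2 * pi" "Re w = cos t" "Im w = sin t"
      by (rule sincos_total_2pi)
    then have "w = cis t" "0 \<le> t" "t < 2 * pi"
      by (simp_all add: complex_eq_iff)
    then show "\<exists>\<phi>. 0 \<le> \<phi> \<and> \<phi> < 1 \<and> w = cis (2 * pi * \<phi>)"
      by (intro exI[of _ "t / (2 * pi)"]) (auto simp: field_simps)
  next
    fix \<phi> \<psi> :: real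
    assume p: "0 \<le> \<phi> \<and> \<phi> < 1 \<and> w = cis (2 * pi * \<phi>)"
      and q: "0 \<le> \<psi> \<and> \<psi> < 1 \<and> w = cis (2 * pi * \<psi>)"
    then have "sin (2 * pi * \<phi>) = sin (2 * pi * \<psi>) \<and> cos (2 * pi * \<phi>) = cos (2 * pi * \<psi>)"
      by (metis cis.sel)
    then obtain n :: int where "2 * pi * \<phi> = 2 * pi * \<psi> + 2 * pi * n"
      using sin_cos_eq_iff by blast
    then have "2 * pi * \<phi> = 2 * pi * (\<psi> + n)"
      by (simp add: algebra_simps)
    then have "\<phi> = \<psi> + n"
      by simp
    moreover from this have "n = 0"
      using p q by linarith
    ultimately show "\<phi> = \<psi>"
      by simp
  qed
qed

end

theory Submission imports Defs begin

text \<open>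
  Conjugating an anti-linear involution \<open>\<sigma>\<close> by multiplication by a unit complex number
  \<open>d\<close> gives \<open>d\<^sup>2 \<sigma>\<close>, because \<open>\<sigma>\<close> turns the factor \<open>d\<inverse>\<close> on its right into
  \<open>cnj (d\<inverse>) = d\<close> on its left. As every unit complex number is a square, an invariant \<open>a\<close>
  takes the same value on \<open>\<sigma>\<close> and on every rotate \<open>e\<^bsup>2\<pi>i\<phi>\<^esup> \<sigma>\<close>. The product of this
  rotate with \<open>\<sigma>\<close> is multiplication by \<open>e\<^bsup>2\<pi>i\<phi>\<^esup>\<close>, whose age is \<open>\<phi>\<close>. The integrality
  condition therefore forces \<open>2 a(\<sigma>) - \<phi>\<close> to be an integer for every \<open>\<phi>\<close> strictly between 0
  and 1, which is absurd: the values for \<open>\<phi> = 1/2\<close> and \<open>\<phi> = 1/4\<close> differ by \<open>1/4\<close>. A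
  complex line does carry some anti-linear involution, namely complex conjugation of the
  coordinate with respect to a generator.
\<close>

lemma antilinear_involution_exists:
  assumes "complex_line s"
  obtains \<sigma> where "antilinear_involution s \<sigma>"
proof -
  interpret vector_space s
    using assms by (simp add: complex_line_def)
  obtain b where b: "b \<noteq> 0" "\<And>x. \<exists>c. x = s c b"
    using complex_line_generator[OF assms] by blast
  then obtain coord where coord: "\<And>x. s (coord x) b = x"
    by metis
  have coord_unique: "coord x = c" if "x = s c b" for x c
    using that b(1) coord by (metis scale_right_imp_eq)
  have "coord (x + y) = coord x + coord y" for x y
    by (rule coord_unique) (simp add: coord scale_left_distrib)
  moreover have "coord (s c x) = c * coord x" for c x
    by (rule coord_unique) (simp add: coord flip: scale_scale)
  moreover have "coord b = 1"
    by (rule coord_unique) simp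
  ultimately have "antilinear_involution s (\<lambda>x. s (cnj (coord x)) b)"
    by (simp add: antilinear_involution_def fun_eq_iff scale_left_distrib coord)
  then show thesis
    by (rule that)
qed

lemma scale_linear_automorphism:
  assumes "vector_space s" "d \<noteq> 0"
  shows "linear_automorphism s (s d)" and "inv (s d) = s (inverse d)"
proof -
  interpret vector_space s
    by fact
  have left: "s (inverse d) \<circ> s d = id" and right: "s d \<circ> s (inverse d) = id"
    using assms(2) by (auto simp: fun_eq_iff)
  show "inv (s d) = s (inverse d)"
    by (rule inv_unique_comp[OF right left])
  have "Vector_Spaces.linear s s (s d)"
    by unfold_locales (simp_all add: scale_right_distrib mult.commute)
  then show "linear_automorphism s (s d)"
    using o_bij[OF left right] by (simp add: linear_automorphism_def)
qed

text \<open>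
  A conjugate of \<open>\<sigma>\<close> by a rotation is a rotate of \<open>\<sigma>\<close> by twice the angle. This is why all
  rotates of \<open>\<sigma>\<close> lie in a single conjugacy class.
\<close>

lemma conjugate_by_unit:
  assumes "vector_space s" "antilinear_involution s \<sigma>" "cmod d = 1"
  shows "s d \<circ> \<sigma> \<circ> inv (s d) = s (d\<^sup>2) \<circ> \<sigma>"
proof -
  interpret vector_space s
    by fact
  have d: "d \<noteq> 0"
    using assms(3) by auto
  have "d * cnj d = 1"
    using assms(3) by (simp flip: complex_norm_square)
  then have "cnj (inverse d) = d"
    using d by (simp add: field_simps)
  then show ?thesis
    using assms(2) scale_linear_automorphism(2)[OF assms(1) d]
    by (simp add: antilinear_involution_def fun_eq_iff power2_eq_square)
qed

lemma antilinear_involution_rotate: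
  assumes "vector_space s" "antilinear_involution s \<sigma>" "cmod w = 1"
  shows "antilinear_involution s (s w \<circ> \<sigma>)"
proof -
  interpret vector_space s
    by fact
  have "w * cnj w = 1"
    using assms(3) by (simp flip: complex_norm_square)
  then show ?thesis
    using assms(2)
    by (simp add: antilinear_involution_def fun_eq_iff scale_right_distrib mult.commute)
qed

lemma rotate_comp_self:
  assumes "antilinear_involution s \<sigma>"
  shows "(s w \<circ> \<sigma>) \<circ> \<sigma> = s w"
  using assms by (simp add: antilinear_involution_def comp_assoc)

text \<open>
  Rotating any anti-linear involution presents the scalar multiplication as a product of two
  anti-linear involutions, so that its angle in \<open>[0, 1)\<close> is unique.
\<close>

lemma age_scale_cis:
  assumes L: "complex_line s" and \<phi>: "0 \<le> \<phi>" "\<phi> < 1"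
  shows "age s (s (cis (2 * pi * \<phi>))) = \<phi>"
proof -
  have V: "vector_space s"
    using L by (simp add: complex_line_def)
  obtain \<sigma> where \<sigma>: "antilinear_involution s \<sigma>"
    using antilinear_involution_exists[OF L] .
  have "antilinear_involution s (s (cis (2 * pi * \<phi>)) \<circ> \<sigma>)"
    using antilinear_involution_rotate[OF V \<sigma>] by simp
  from age_well_defined[OF L this \<sigma>]
  show ?thesis
    unfolding age_def rotate_comp_self[OF \<sigma>]
    by (rule the1_equality) (simp add: \<phi> cis_conv_exp mult_ac)
qed

lemma scale_cis_neq_id:
  assumes L: "complex_line s" and \<phi>: "0 < \<phi>" "\<phi> < 1"
  shows "s (cis (2 * pi * \<phi>)) \<noteq> id"
proof
  interpret vector_space s
    using L by (simp add: complex_line_def)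
  assume "s (cis (2 * pi * \<phi>)) = id"
  then have "s (cis (2 * pi * \<phi>)) = s (cis (2 * pi * 0))"
    by (simp add: fun_eq_iff)
  then show False
    using age_scale_cis[OF L, of \<phi>] age_scale_cis[OF L, of 0] \<phi> by simp
qed

theorem theorem1p2:
  fixes s :: "complex \<Rightarrow> 'v::ab_group_add \<Rightarrow> 'v"
  assumes "complex_line s"
  shows "\<not> (\<exists>a :: ('v \<Rightarrow> 'v) \<Rightarrow> real.
           (\<forall>\<sigma> U. antilinear_involution s \<sigma> \<longrightarrow> linear_automorphism s U \<longrightarrow>
                  a (U \<circ> \<sigma> \<circ> inv U) = a \<sigma>) \<and>
           (\<forall>\<sigma> \<rho>. antilinear_involution s \<sigma> \<longrightarrow> antilinear_involution s \<rho> \<longrightarrow>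
                  \<sigma> \<circ> \<rho> \<noteq> id \<longrightarrow> a \<sigma> + a \<rho> - age s (\<sigma> \<circ> \<rho>) \<in> \<int>))"
proof
  assume "\<exists>a :: ('v \<Rightarrow> 'v) \<Rightarrow> real.
           (\<forall>\<sigma> U. antilinear_involution s \<sigma> \<longrightarrow> linear_automorphism s U \<longrightarrow>
                  a (U \<circ> \<sigma> \<circ> inv U) = a \<sigma>) \<and>
           (\<forall>\<sigma> \<rho>. antilinear_involution s \<sigma> \<longrightarrow> antilinear_involution s \<rho> \<longrightarrow>
                  \<sigma> \<circ> \<rho> \<noteq> id \<longrightarrow> a \<sigma> + a \<rho> - age s (\<sigma> \<circ> \<rho>) \<in> \<int>)"
  then obtain a :: "('v \<Rightarrow> 'v) \<Rightarrow> real"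
    where invariant: "\<And>\<sigma> U. antilinear_involution s \<sigma> \<Longrightarrow> linear_automorphism s U \<Longrightarrow>
        a (U \<circ> \<sigma> \<circ> inv U) = a \<sigma>"
      and integral: "\<And>\<sigma> \<rho>. antilinear_involution s \<sigma> \<Longrightarrow> antilinear_involution s \<rho> \<Longrightarrow>
        \<sigma> \<circ> \<rho> \<noteq> id \<Longrightarrow> a \<sigma> + a \<rho> - age s (\<sigma> \<circ> \<rho>) \<in> \<int>"
    by blast
  have V: "vector_space s"
    using assms by (simp add: complex_line_def)
  obtain \<sigma> where \<sigma>: "antilinear_involution s \<sigma>"
    using antilinear_involution_exists[OF assms] .
  have key: "2 * a \<sigma> - \<phi> \<in> \<int>" if \<phi>: "0 < \<phi>" "\<phi> < 1" for \<phi>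
  proof -
    define d where "d = cis (pi * \<phi>)"
    have d: "cmod d = 1" "d \<noteq> 0" and d2: "d\<^sup>2 = cis (2 * pi * \<phi>)"
      by (simp_all add: d_def DeMoivre mult.assoc)
    have "a (s (d\<^sup>2) \<circ> \<sigma>) = a \<sigma>"
      using invariant[OF \<sigma> scale_linear_automorphism(1)[OF V d(2)]]
      by (simp add: conjugate_by_unit[OF V \<sigma> d(1)])
    moreover have "antilinear_involution s (s (d\<^sup>2) \<circ> \<sigma>)"
      using antilinear_involution_rotate[OF V \<sigma>] d(1) by (simp add: norm_power)
    ultimately show ?thesis
      using integral[of "s (d\<^sup>2) \<circ> \<sigma>" \<sigma>] \<sigma> \<phi> scale_cis_neq_id[OF assms \<phi>]
      by (simp add: rotate_comp_self[OF \<sigma>] d2 age_scale_cis[OF assms])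
  qed
  have "(2 * a \<sigma> - 1/4) - (2 * a \<sigma> - 1/2) \<in> \<int>"
    by (intro Ints_diff key) simp_all
  then obtain n :: int where "1/4 = real_of_int n"
    by (auto elim: Ints_cases)
  then have "real_of_int (4 * n) = real_of_int 1"
    unfolding of_int_mult of_int_numeral of_int_1 by linarith
  then have "4 * n = 1"
    by (simp only: of_int_eq_iff)
  then show False
    by presburger
qed

end
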